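(* There exist an absolute constant $c_0>0$ and infinitely many positive integers $n$ for which there are an abelian group $G$ of order $n$ and a symmetric generating set $S\subseteq G$ with $|S|\ge c_0\sqrt{n}$ such that the Cayley graph $\mathcal{C}(G,S)$ is $K_{2,3}$-free. In particular, the upper bound $O(n^{3/2})$ on the number of edges of a $K_{2,3}$-free graph on $n$ vertices is tight up to a multiplicative constant even for abelian Cayley graphs.
   Context: For a finite abelian group $G$ (written additively) and a symmetric subset $S\subseteq G$ (i.e. $a\in S\Rightarrow -a\in S$) with $0\notin S$, the Cayley graph $\mathcal{C}(G,S)$ is the simple undirected graph with vertex set $G$ in which $g$ and $h$ are adjacent if and only if $g-h\in S$. A graph is $K_{2,3}$-free if it contains no (not necessarily induced) subgraph isomorphic to the complete bipartite graph $K_{2,3}$. Tightness up to a multiplicative constant means that for infinitely many $n$ there is a $K_{2,3}$-free abelian Cayley graph on $n$ vertices with at least $c_1 n^{3/2}$ edges, for some absolute constant $c_1>0$. *)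

theory Defs
  imports
    Complex_Main
    "HOL-Algebra.Generated_Groups"
    "Graph_Theory.Graph_Theory"
begin

(* Groups are written multiplicatively, as in HOL-Algebra: the additive a + b, -a, 0 and
   g - h of an abelian group are a \<otimes> b, inv a, \<one> and g \<otimes> inv h here. *)

definition connection_set :: "('a, 'b) monoid_scheme \<Rightarrow> 'a set \<Rightarrow> bool" where
  "connection_set G S \<longleftrightarrow>
     S \<subseteq> carrier G \<and> \<one>\<^bsub>G\<^esub> \<notin> S \<and> (\<forall>a\<in>S. inv\<^bsub>G\<^esub> a \<in> S)"

(* In Graph_Theory a simple undirected graph is a finite, symmetric, loop-free digraph without
   parallel arcs: an edge gh is the pair of arcs (g, h) and (h, g). *)

definition cayley_graph :: "('a, 'b) monoid_scheme \<Rightarrow> 'a set \<Rightarrow> 'a pair_pre_digraph" where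
  "cayley_graph G S =
     \<lparr> pverts = carrier G,
       parcs = {(g, h). g \<in> carrier G \<and> h \<in> carrier G \<and> g \<otimes>\<^bsub>G\<^esub> inv\<^bsub>G\<^esub> h \<in> S} \<rparr>"

lemma pair_graph_cayley_graph:
  assumes "group G" "finite (carrier G)" "connection_set G S"
  shows "pair_graph (cayley_graph G S)"
proof -
  interpret group G by fact
  have sub: "parcs (cayley_graph G S) \<subseteq> carrier G \<times> carrier G"
    by (auto simp: cayley_graph_def)
  have fin: "finite (parcs (cayley_graph G S))"
    using finite_subset[OF sub] assms(2) by simp
  have symm: "h \<otimes>\<^bsub>G\<^esub> inv\<^bsub>G\<^esub> g \<in> S"
    if "g \<in> carrier G" "h \<in> carrier G" "g \<otimes>\<^bsub>G\<^esub> inv\<^bsub>G\<^esub> h \<in> S" for g h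
  proof -
    have "inv\<^bsub>G\<^esub> (g \<otimes>\<^bsub>G\<^esub> inv\<^bsub>G\<^esub> h) \<in> S"
      using assms(3) that by (auto simp: connection_set_def)
    then show ?thesis using that by (simp add: inv_mult_group)
  qed
  show ?thesis
  proof
    show "symmetric (with_proj (cayley_graph G S))"
      using symm by (auto simp: symmetric_def cayley_graph_def intro!: symI)
  qed (use fin sub assms in \<open>auto simp: cayley_graph_def connection_set_def\<close>)
qed

definition K23_free :: "('a, 'b) pre_digraph \<Rightarrow> bool" where
  "K23_free X \<longleftrightarrow> \<not> (\<exists>H. subgraph H X \<and> K\<^bsub>2,3\<^esub> H)"

(* Undirected edges, so that the two arcs of an edge are counted once. *)
definition edge_set :: "('a, 'b) pre_digraph \<Rightarrow> 'a set set" where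
  "edge_set X = {{u, v} | u v. (u, v) \<in> arcs_ends X}"

end

theory Submission
  imports Defs "HOL-Library.Nat_Bijection" "HOL-Number_Theory.Cong"
begin

text \<open>
  Let \<open>p > 3\<close> be a prime. The group is \<open>G = (\<int>/p)\<^sup>2\<close>, of order \<open>n = p\<^sup>2\<close>, and \<open>S\<close> is the
  cubic curve \<open>{(x, x\<^sup>3) | x \<noteq> 0}\<close>, which has \<open>p - 1 \<ge> \<surd>n / 2\<close> points and is symmetric because
  cubing is odd.

  Two vertices \<open>g \<noteq> h\<close> have a common neighbour \<open>x\<close> for each way of writing \<open>g - h\<close> as the sum of
  \<open>g - x\<close> and \<open>x - h\<close>, both in \<open>S\<close>. So the Cayley graph is \<open>K\<^sub>2\<^sub>,\<^sub>3\<close>-free as soon as a nonzero element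
  of \<open>G\<close> is a sum of two elements of \<open>S\<close> in at most one way up to the order of the summands
  (\<open>K23_free_cayley_graph\<close>). The zero element has to be exempted, as \<open>S\<close> is symmetric. For the cubic
  curve, if \<open>a + b = c + d\<close> and \<open>a\<^sup>3 + b\<^sup>3 = c\<^sup>3 + d\<^sup>3\<close>, then
  \<open>3 (a + b) (c - a) (c - b) = 0\<close> (\<open>cube_sum_dvd\<close>): either \<open>c\<close> is one of \<open>a\<close>, \<open>b\<close>, or \<open>b = -a\<close>, in
  which case the two points of the curve add up to zero.

  The points \<open>(1, 1)\<close> and \<open>(2, 8)\<close> of \<open>S\<close> form a matrix of determinant \<open>6\<close>, which is invertible modulo
  \<open>p\<close>, so \<open>S\<close> generates \<open>G\<close>. The graph is \<open>|S|\<close>-regular, hence it has \<open>n |S| / 2\<close> edges, which is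
  at least \<open>n\<^sup>3\<^sup>/\<^sup>2 / 4\<close>.
\<close>

section \<open>Cayley graphs\<close>

text \<open>
  If \<open>g\<close> and \<open>h\<close> are the two vertices on one side of a \<open>K\<^sub>2\<^sub>,\<^sub>3\<close> and \<open>x\<close> runs over the other side, the
  first factors of \<open>g h\<inverse> = (g x\<inverse>) (x h\<inverse>)\<close> take three different values, although the hypothesis
  allows only two.
\<close>

lemma K23_free_cayley_graph:
  fixes G (structure)
  assumes "group G" and S: "S \<subseteq> carrier G"
    and unique: "\<And>a b c d. \<lbrakk>a \<in> S; b \<in> S; c \<in> S; d \<in> S; a \<otimes> b = c \<otimes> d; a \<otimes> b \<noteq> \<one>\<rbrakk> \<Longrightarrow> c = a \<or> c = b"
  shows "K23_free (with_proj (cayley_graph G S))"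
  unfolding K23_free_def
proof
  interpret group G by fact
  assume "\<exists>H. subgraph H (with_proj (cayley_graph G S)) \<and> K\<^bsub>2,3\<^esub> H"
  then obtain H U V where sub: "subgraph H (with_proj (cayley_graph G S))"
    and cards: "card U = 2" "card V = 3" and arcs: "arcs_ends H = U \<times> V \<union> V \<times> U"
    by (auto simp: complete_bipartite_digraph_def)
  have arc: "u \<in> carrier G \<and> v \<in> carrier G \<and> u \<otimes> inv v \<in> S" if "(u, v) \<in> U \<times> V \<union> V \<times> U" for u v
  proof -
    have "(u, v) \<in> arcs_ends H"
      using that arcs by simp
    then have "(u, v) \<in> parcs (cayley_graph G S)"
      using sub by (auto simp: subgraph_def compatible_def arcs_ends_def arc_to_ends_def with_proj_def)
    then show ?thesis
      by (simp add: cayley_graph_def)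
  qed
  obtain g h where U: "U = {g, h}" "g \<noteq> h"
    using cards(1) by (auto simp: card_2_iff)
  obtain x y z where V: "V = {x, y, z}" "x \<noteq> y" "x \<noteq> z" "y \<noteq> z"
    using cards(2) by (auto simp: card_3_iff)
  have gh: "g \<in> carrier G" "h \<in> carrier G"
    using arc[of g x] arc[of h x] U V by auto
  have V_carrier: "v \<in> carrier G" and to_S: "g \<otimes> inv v \<in> S" "v \<otimes> inv h \<in> S" if "v \<in> V" for v
    using arc[of g v] arc[of v h] U that by auto
  have factor: "(g \<otimes> inv v) \<otimes> (v \<otimes> inv h) = g \<otimes> inv h" if "v \<in> V" for v
    using V_carrier[OF that] gh by (simp add: m_assoc inv_solve_left' flip: m_assoc[of "inv v" v])
  have "g \<otimes> inv h \<noteq> \<one>"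
    using gh U(2) by (metis inv_closed inv_inv inv_equality)
  then have two: "g \<otimes> inv w = g \<otimes> inv x \<or> g \<otimes> inv w = x \<otimes> inv h" if "w \<in> V" for w
    using unique[OF to_S[of x] to_S[OF that]] factor[of x] factor[OF that] V(1) by auto
  have inj: "v = w" if "g \<otimes> inv v = g \<otimes> inv w" "v \<in> V" "w \<in> V" for v w
    using that V_carrier gh by (metis inv_closed inv_inv Units_l_cancel Units_eq)
  show False
    using two[of y] two[of z] inj V by (metis insertI1 insertI2)
qed

text \<open>
  Every arc is one of the two orientations of its edge; a choice of one orientation \<open>r e\<close> for each
  edge \<open>e\<close> therefore covers all arcs by \<open>r\<close> and its reversal.
\<close>

lemma card_arcs_ends_le_edge_set:
  assumes "finite (arcs_ends X)"
  shows "card (arcs_ends X) \<le> 2 * card (edge_set X)"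
proof -
  define r where "r = (\<lambda>e. SOME (u, v). (u, v) \<in> arcs_ends X \<and> e = {u, v})"
  have r: "\<exists>u v. r e = (u, v) \<and> e = {u, v}" if "e \<in> edge_set X" for e
  proof -
    have "\<exists>q. case q of (u, v) \<Rightarrow> (u, v) \<in> arcs_ends X \<and> e = {u, v}"
      using that by (auto simp: edge_set_def)
    from someI_ex[OF this] show ?thesis
      unfolding r_def by (auto split: prod.splits)
  qed
  have "edge_set X = (\<lambda>(u, v). {u, v}) ` arcs_ends X"
    by (auto simp: edge_set_def)
  then have fin: "finite (edge_set X)"
    using assms by simp
  have "arcs_ends X \<subseteq> r ` edge_set X \<union> (prod.swap \<circ> r) ` edge_set X"
  proof
    fix q assume q: "q \<in> arcs_ends X"
    obtain u v where uv: "q = (u, v)"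
      by (cases q)
    have e: "{u, v} \<in> edge_set X"
      using q uv by (auto simp: edge_set_def)
    then have "q = r {u, v} \<or> q = prod.swap (r {u, v})"
      using r[OF e] uv by (auto simp: doubleton_eq_iff)
    then show "q \<in> r ` edge_set X \<union> (prod.swap \<circ> r) ` edge_set X"
      using e by auto
  qed
  then have "card (arcs_ends X) \<le> card (r ` edge_set X \<union> (prod.swap \<circ> r) ` edge_set X)"
    using fin by (intro card_mono) auto
  also have "\<dots> \<le> card (r ` edge_set X) + card ((prod.swap \<circ> r) ` edge_set X)"
    by (rule card_Un_le)
  also have "\<dots> \<le> 2 * card (edge_set X)"
    using card_image_le[OF fin, of r] card_image_le[OF fin, of "prod.swap \<circ> r"] by linarith
  finally show ?thesis .
qed

lemma card_edge_set_cayley_graph: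
  fixes G (structure)
  assumes "group G" "finite (carrier G)" and S: "S \<subseteq> carrier G"
  shows "order G * card S \<le> 2 * card (edge_set (with_proj (cayley_graph G S)))"
proof -
  interpret group G by fact
  let ?A = "arcs_ends (with_proj (cayley_graph G S))"
  have A: "?A = {(g, h). g \<in> carrier G \<and> h \<in> carrier G \<and> g \<otimes> inv h \<in> S}"
    by (auto simp: arcs_ends_def arc_to_ends_def with_proj_def cayley_graph_def)
  have fin: "finite ?A"
    by (rule finite_subset[of _ "carrier G \<times> carrier G"]) (use A assms(2) in auto)
  have "(\<lambda>(h, s). (s \<otimes> h, h)) ` (carrier G \<times> S) \<subseteq> ?A"
    unfolding A using S by (auto simp: m_assoc subset_iff)
  moreover have "inj_on (\<lambda>(h, s). (s \<otimes> h, h)) (carrier G \<times> S)"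
    using S by (auto simp: inj_on_def subset_iff)
  ultimately have "card (carrier G \<times> S) \<le> card ?A"
    using card_inj_on_le fin by blast
  then show ?thesis
    using card_arcs_ends_le_edge_set[OF fin] by (simp add: card_cartesian_product order_def)
qed

section \<open>The group of pairs of residues\<close>

text \<open>
  Integer arguments let arithmetic in \<open>(\<int>/p)\<^sup>2\<close> be done on arbitrary representatives of the residue
  classes; the encoding of pairs makes the group one of natural numbers.
\<close>

definition residue_pair :: "nat \<Rightarrow> int \<Rightarrow> int \<Rightarrow> nat" where
  "residue_pair p x y = prod_encode (nat (x mod int p), nat (y mod int p))"

definition residue_plane :: "nat \<Rightarrow> nat monoid" where
  "residue_plane p =
     \<lparr> carrier = {residue_pair p x y | x y. True},
       monoid.mult = (\<lambda>u v. residue_pair p (int (fst (prod_decode u)) + int (fst (prod_decode v)))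
                                    (int (snd (prod_decode u)) + int (snd (prod_decode v)))),
       monoid.one = residue_pair p 0 0 \<rparr>"

lemma residue_pair_eq_iff:
  assumes "p > 0"
  shows "residue_pair p x y = residue_pair p x' y' \<longleftrightarrow> int p dvd x - x' \<and> int p dvd y - y'"
  using assms by (simp add: residue_pair_def mod_eq_dvd_iff eq_nat_nat_iff)

lemma carrier_residue_plane: "carrier (residue_plane p) = {residue_pair p x y | x y. True}"
  by (simp add: residue_plane_def)

lemma residue_pair_in_carrier [simp]: "residue_pair p x y \<in> carrier (residue_plane p)"
  by (auto simp: carrier_residue_plane)

lemma one_residue_plane: "\<one>\<^bsub>residue_plane p\<^esub> = residue_pair p 0 0"
  by (simp add: residue_plane_def)

lemma mult_residue_plane:
  assumes "p > 0"
  shows "residue_pair p x y \<otimes>\<^bsub>residue_plane p\<^esub> residue_pair p x' y' = residue_pair p (x + x') (y + y')"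
  using assms by (simp add: residue_plane_def residue_pair_def mod_add_eq)

lemma comm_group_residue_plane:
  assumes "p > 0"
  shows "comm_group (residue_plane p)"
proof (rule comm_groupI)
  fix u assume "u \<in> carrier (residue_plane p)"
  then obtain x y where "u = residue_pair p x y"
    by (auto simp: carrier_residue_plane)
  then show "\<exists>v \<in> carrier (residue_plane p). v \<otimes>\<^bsub>residue_plane p\<^esub> u = \<one>\<^bsub>residue_plane p\<^esub>"
    by (intro bexI[of _ "residue_pair p (- x) (- y)"])
      (simp_all add: mult_residue_plane[OF assms] one_residue_plane)
qed (use assms in \<open>(auto simp: carrier_residue_plane one_residue_plane mult_residue_plane algebra_simps; blast)+\<close>)

lemma inv_residue_plane:
  assumes "p > 0"
  shows "inv\<^bsub>residue_plane p\<^esub> residue_pair p x y = residue_pair p (- x) (- y)"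
proof -
  interpret comm_group "residue_plane p"
    using comm_group_residue_plane[OF assms] .
  show ?thesis
    by (rule inv_equality) (simp_all add: mult_residue_plane[OF assms] one_residue_plane)
qed

lemma carrier_residue_plane_encode:
  assumes "p > 0"
  shows "carrier (residue_plane p) = prod_encode ` ({..<p} \<times> {..<p})"
proof
  show "carrier (residue_plane p) \<subseteq> prod_encode ` ({..<p} \<times> {..<p})"
    using assms by (auto simp: carrier_residue_plane residue_pair_def nat_less_iff)
  have "prod_encode (i, j) = residue_pair p (int i) (int j)" if "i < p" "j < p" for i j
    using that by (simp add: residue_pair_def)
  then show "prod_encode ` ({..<p} \<times> {..<p}) \<subseteq> carrier (residue_plane p)"
    by auto
qed

lemma order_residue_plane:
  assumes "p > 0"
  shows "order (residue_plane p) = p\<^sup>2"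
  by (simp add: order_def carrier_residue_plane_encode[OF assms] card_image inj_prod_encode
      card_cartesian_product power2_eq_square)

lemma finite_residue_plane:
  assumes "p > 0"
  shows "finite (carrier (residue_plane p))"
  by (simp add: carrier_residue_plane_encode[OF assms])

section \<open>The cubic curve\<close>

definition cubic_curve :: "nat \<Rightarrow> nat set" where
  "cubic_curve p = {residue_pair p x (x ^ 3) | x. \<not> int p dvd x}"

lemma cubic_curveI: "\<not> int p dvd x \<Longrightarrow> residue_pair p x (x ^ 3) \<in> cubic_curve p"
  by (auto simp: cubic_curve_def)

lemma connection_set_cubic_curve:
  assumes "p > 0"
  shows "connection_set (residue_plane p) (cubic_curve p)"
proof -
  have "inv\<^bsub>residue_plane p\<^esub> residue_pair p x (x ^ 3) \<in> cubic_curve p" if "\<not> int p dvd x" for x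
    using cubic_curveI[of p "- x"] that by (simp add: inv_residue_plane[OF assms])
  then show ?thesis
    by (auto simp: connection_set_def cubic_curve_def one_residue_plane residue_pair_eq_iff[OF assms])
qed

lemma card_cubic_curve:
  assumes "p > 0"
  shows "card (cubic_curve p) = p - 1"
proof -
  let ?f = "\<lambda>x. residue_pair p x (x ^ 3)"
  have "cubic_curve p = ?f ` {1..<int p}"
  proof
    show "cubic_curve p \<subseteq> ?f ` {1..<int p}"
    proof
      fix u assume "u \<in> cubic_curve p"
      then obtain x where x: "u = ?f x" "\<not> int p dvd x"
        by (auto simp: cubic_curve_def)
      have "x mod int p \<noteq> 0" "0 \<le> x mod int p" "x mod int p < int p"
        using x(2) assms by (auto simp: dvd_eq_mod_eq_0)
      moreover have "u = ?f (x mod int p)"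
        by (simp add: x(1) residue_pair_def power_mod)
      ultimately show "u \<in> ?f ` {1..<int p}"
        by (intro image_eqI[of _ _ "x mod int p"]) auto
    qed
    show "?f ` {1..<int p} \<subseteq> cubic_curve p"
      by (auto intro!: cubic_curveI dest: zdvd_imp_le)
  qed
  moreover have "inj_on ?f {1..<int p}"
    by (auto simp: inj_on_def residue_pair_def)
  ultimately show ?thesis
    by (simp add: card_image)
qed

text \<open>
  Substituting \<open>d = a + b - c\<close> turns \<open>c\<^sup>3 + d\<^sup>3 - (a\<^sup>3 + b\<^sup>3)\<close> into exactly
  \<open>3 (a + b) (c - a) (c - b)\<close>.
\<close>

lemma cube_sum_dvd:
  fixes a b c d m :: int
  assumes "m dvd (a + b) - (c + d)" and "m dvd (a ^ 3 + b ^ 3) - (c ^ 3 + d ^ 3)"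
  shows "m dvd 3 * (a + b) * (c - a) * (c - b)"
proof -
  define s where "s = a + b - c"
  have "3 * (a + b) * (c - a) * (c - b) = (s ^ 3 - d ^ 3) - ((a ^ 3 + b ^ 3) - (c ^ 3 + d ^ 3))"
    by (simp add: s_def power3_eq_cube algebra_simps)
  moreover have "s ^ 3 - d ^ 3 = ((a + b) - (c + d)) * (s\<^sup>2 + s * d + d\<^sup>2)"
    by (simp add: s_def power3_eq_cube power2_eq_square algebra_simps)
  ultimately show ?thesis
    using assms by (metis dvd_diff dvd_mult2)
qed

lemma cubic_curve_unique_sum:
  assumes "prime p" "p > 3"
    and S: "u \<in> cubic_curve p" "v \<in> cubic_curve p" "w \<in> cubic_curve p" "t \<in> cubic_curve p"
    and eq: "u \<otimes>\<^bsub>residue_plane p\<^esub> v = w \<otimes>\<^bsub>residue_plane p\<^esub> t"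
    and ne: "u \<otimes>\<^bsub>residue_plane p\<^esub> v \<noteq> \<one>\<^bsub>residue_plane p\<^esub>"
  shows "w = u \<or> w = v"
proof -
  have p: "p > 0" and prime: "prime (int p)"
    using assms(1,2) by auto
  note plane = mult_residue_plane[OF p] one_residue_plane residue_pair_eq_iff[OF p]
  obtain a b c d where pts: "u = residue_pair p a (a ^ 3)" "v = residue_pair p b (b ^ 3)"
      "w = residue_pair p c (c ^ 3)" "t = residue_pair p d (d ^ 3)"
    using S by (auto simp: cubic_curve_def)
  have "int p dvd 3 * (a + b) * (c - a) * (c - b)"
    by (rule cube_sum_dvd[of _ a b c d]) (use eq in \<open>simp_all add: pts plane\<close>)
  moreover have "\<not> int p dvd 3"
    using assms(2) by (auto dest: zdvd_imp_le)
  moreover have "\<not> int p dvd a + b"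
  proof
    assume dvd: "int p dvd a + b"
    have "a ^ 3 + b ^ 3 = (a + b) * (a\<^sup>2 - a * b + b\<^sup>2)"
      by (simp add: power3_eq_cube power2_eq_square algebra_simps)
    then have "int p dvd a ^ 3 + b ^ 3"
      using dvd by simp
    then show False
      using ne dvd by (simp add: pts plane)
  qed
  ultimately have "int p dvd c - a \<or> int p dvd c - b"
    using prime by (metis prime_dvd_mult_iff)
  moreover have "residue_pair p c (c ^ 3) = residue_pair p e (e ^ 3)" if "int p dvd c - e" for e
  proof -
    have "c ^ 3 - e ^ 3 = (c - e) * (c\<^sup>2 + c * e + e\<^sup>2)"
      by (simp add: power3_eq_cube power2_eq_square algebra_simps)
    then show ?thesis
      using that by (simp add: plane)
  qed
  ultimately show ?thesis
    by (auto simp: pts)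
qed

lemma generate_cubic_curve:
  assumes "prime p" "p > 3"
  shows "generate (residue_plane p) (cubic_curve p) = carrier (residue_plane p)"
proof -
  have p: "p > 0"
    using assms(2) by simp
  interpret comm_group "residue_plane p"
    using comm_group_residue_plane[OF p] .
  let ?H = "generate (residue_plane p) (cubic_curve p)"
  have S: "cubic_curve p \<subseteq> carrier (residue_plane p)"
    by (auto simp: cubic_curve_def)
  have multiples: "residue_pair p (int n * x) (int n * x ^ 3) \<in> ?H" if "\<not> int p dvd x" for n x
  proof (induction n)
    case 0
    then show ?case
      using generate.one[of "residue_plane p"] by (simp add: one_residue_plane)
  next
    case (Suc n)
    have "residue_pair p x (x ^ 3) \<in> ?H"
      using that by (intro generate.incl cubic_curveI)
    from generate.eng[OF this Suc] show ?case
      by (simp add: mult_residue_plane[OF p] algebra_simps)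
  qed
  have not_dvd: "\<not> int p dvd 2" "\<not> int p dvd 3"
    using assms(2) by (auto dest: zdvd_imp_le)
  have "coprime (6::int) (int p)"
  proof -
    have "\<not> int p dvd 2 * 3"
      using assms(1) not_dvd by (metis prime_dvd_mult_iff prime_nat_int_transfer)
    then show ?thesis
      using assms(1) prime_imp_coprime[of "int p" 6] by (simp add: coprime_commute)
  qed
  then obtain k :: int where k: "int p dvd 6 * k - 1"
    using cong_solve_coprime_int[of 6 "int p"] by (auto simp: cong_iff_dvd_diff)
  have "residue_pair p x y \<in> ?H" for x y
  proof -
    \<comment> \<open>Cramer's rule for \<open>(x, y) = i (1, 1) + j (2, 8)\<close>, with \<open>k\<close> inverse to the determinant.\<close>
    define j where "j = k * (y - x)"
    define i where "i = x - 2 * j"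
    define i' j' where "i' = i mod int p" and "j' = j mod int p"
    have ij: "i' = int (nat i')" "j' = int (nat j')"
      using p by (simp_all add: i'_def j'_def)
    have "residue_pair p i' i' \<in> ?H"
      using multiples[of 1 "nat i'"] ij assms(2) by (simp add: zdvd1_eq)
    moreover have "residue_pair p (2 * j') (8 * j') \<in> ?H"
      using multiples[of 2 "nat j'"] ij not_dvd(1) by (simp add: mult.commute)
    ultimately have "residue_pair p (i' + 2 * j') (i' + 8 * j') \<in> ?H"
      using generate.eng by (fastforce simp: mult_residue_plane[OF p])
    moreover have "residue_pair p (i' + 2 * j') (i' + 8 * j') = residue_pair p x y"
    proof -
      have di: "int p dvd i' - i" and dj: "int p dvd j' - j"
        by (simp_all add: i'_def j'_def mod_eq_dvd_iff[symmetric])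
      have x: "(i' + 2 * j') - x = (i' - i) + 2 * (j' - j)"
        by (simp add: i_def)
      have y: "(i' + 8 * j') - y = (i' - i) + 8 * (j' - j) + (6 * k - 1) * (y - x)"
        by (simp add: i_def j_def algebra_simps)
      show ?thesis
        unfolding residue_pair_eq_iff[OF p] x y by (intro conjI dvd_add dvd_mult dvd_mult2 di dj k)
    qed
    ultimately show ?thesis
      by simp
  qed
  then have "carrier (residue_plane p) \<subseteq> ?H"
    by (auto simp: carrier_residue_plane)
  then show ?thesis
    using generate_in_carrier[OF S] by blast
qed

lemma K23_free_cubic_curve:
  assumes "prime p" "p > 3"
  shows "K23_free (with_proj (cayley_graph (residue_plane p) (cubic_curve p)))"
proof (rule K23_free_cayley_graph)
  show "group (residue_plane p)"
    using comm_group_residue_plane[of p] assms(2) by (simp add: comm_group_def)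
  show "cubic_curve p \<subseteq> carrier (residue_plane p)"
    by (auto simp: cubic_curve_def)
qed (use cubic_curve_unique_sum[OF assms] in blast)

lemma infinite_prime_squares:
  assumes "\<And>p::nat. \<lbrakk>prime p; p > 3\<rbrakk> \<Longrightarrow> P (p\<^sup>2)"
  shows "infinite {n. P n}"
proof -
  have "infinite ({p::nat. prime p} - {..3})"
    using primes_infinite by (simp add: Diff_infinite_finite)
  moreover have "inj_on (\<lambda>p::nat. p\<^sup>2) ({p. prime p} - {..3})"
    by (auto simp: inj_on_def)
  ultimately have "infinite ((\<lambda>p::nat. p\<^sup>2) ` ({p. prime p} - {..3}))"
    by (simp add: finite_image_iff)
  moreover have "(\<lambda>p. p\<^sup>2) ` ({p. prime p} - {..3}) \<subseteq> {n. P n}"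
    using assms by auto
  ultimately show ?thesis
    using infinite_super by blast
qed

section \<open>Dense \<open>K\<^sub>2\<^sub>,\<^sub>3\<close>-free abelian Cayley graphs\<close>

theorem mainTheorem3:
  shows "(\<exists>c0::real. c0 > 0 \<and>
            infinite {n::nat. n > 0 \<and>
              (\<exists>(G :: nat monoid) S.
                 comm_group G \<and> order G = n \<and>
                 connection_set G S \<and> generate G S = carrier G \<and>
                 real (card S) \<ge> c0 * sqrt (real n) \<and>
                 K23_free (with_proj (cayley_graph G S)))})
       \<and> (\<exists>c1::real. c1 > 0 \<and>
            infinite {n::nat. n > 0 \<and>
              (\<exists>(G :: nat monoid) S.
                 comm_group G \<and> order G = n \<and>
                 connection_set G S \<and>
                 K23_free (with_proj (cayley_graph G S)) \<and>
                 real (card (edge_set (with_proj (cayley_graph G S)))) \<ge> c1 * real n powr (3/2))})"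
proof (rule conjI[OF exI[of _ "1/2", OF conjI[OF _ infinite_prime_squares]]
                     exI[of _ "1/4", OF conjI[OF _ infinite_prime_squares]]])
  fix p :: nat
  assume p: "prime p" "p > 3"
  then have pos: "p > 0"
    by simp
  let ?G = "residue_plane p" and ?S = "cubic_curve p"
  have G: "comm_group ?G" "order ?G = p\<^sup>2"
    using comm_group_residue_plane order_residue_plane pos by auto
  have S: "connection_set ?G ?S" "generate ?G ?S = carrier ?G"
    using connection_set_cubic_curve generate_cubic_curve p pos by auto
  have free: "K23_free (with_proj (cayley_graph ?G ?S))"
    using K23_free_cubic_curve[OF p] .
  have card_S: "real (card ?S) \<ge> 1/2 * real p"
    using p(2) by (simp add: card_cubic_curve of_nat_diff)
  have sqrt_order: "sqrt (real (p\<^sup>2)) = real p"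
    by simp
  show "p\<^sup>2 > 0 \<and> (\<exists>(G :: nat monoid) S. comm_group G \<and> order G = p\<^sup>2 \<and>
      connection_set G S \<and> generate G S = carrier G \<and>
      real (card S) \<ge> 1/2 * sqrt (real (p\<^sup>2)) \<and> K23_free (with_proj (cayley_graph G S)))"
    unfolding sqrt_order using G S free card_S pos by (intro conjI exI[of _ ?G] exI[of _ ?S]) auto
  let ?E = "edge_set (with_proj (cayley_graph ?G ?S))"
  have "p\<^sup>2 * card ?S \<le> 2 * card ?E"
    using card_edge_set_cayley_graph[of ?G ?S] G S finite_residue_plane[OF pos]
    by (auto simp: connection_set_def comm_group_def)
  then have "real (p\<^sup>2 * card ?S) \<le> real (2 * card ?E)"
    by (rule of_nat_mono)
  moreover have "(real p)\<^sup>2 * (1/2 * real p) \<le> (real p)\<^sup>2 * real (card ?S)"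
    using card_S by (intro mult_left_mono) auto
  moreover have "real (p\<^sup>2) powr (3/2) = real p ^ 3"
    using pos by (simp add: powr_powr flip: powr_numeral)
  ultimately have "real (card ?E) \<ge> 1/4 * real (p\<^sup>2) powr (3/2)"
    by (simp add: power2_eq_square power3_eq_cube)
  then show "p\<^sup>2 > 0 \<and> (\<exists>(G :: nat monoid) S. comm_group G \<and> order G = p\<^sup>2 \<and>
      connection_set G S \<and> K23_free (with_proj (cayley_graph G S)) \<and>
      real (card (edge_set (with_proj (cayley_graph G S)))) \<ge> 1/4 * real (p\<^sup>2) powr (3/2))"
    using G S free pos by (intro conjI exI[of _ ?G] exI[of _ ?S]) auto
qed auto

end
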